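(* Let $p\in\{-2,2\}$ and $q=2$, let $\tau\in\mathbb{C}$ satisfy $\tau^2-p\tau+q=0$, let $w$ be an odd integer with $w\ge 3$, let $\mathcal{D}$ be the minimal norm representatives digit set modulo $\tau^w$, and let $z\in\mathbb{Z}[\tau]$. Then the $w$-NAF-expansion (base $\tau$, digit set $\mathcal{D}$) of $z$ is optimal.
   Context: Voronoi cell: $V=\{z\in\mathbb{C}:\ |z|\le|z-y|\text{ for all }y\in\mathbb{Z}[\tau]\}$. Writing $\{x\}$ for the fractional part and $r=\{\mathrm{Re}\,\tau\}$, $t=\mathrm{Im}\,\tau$, its vertices, in cyclic order, are $v_0=\frac12+\frac{i}{2t}(t^2+r^2-r)$, $v_1=r-\frac12+\frac{i}{2t}(t^2-r^2+r)$, $v_2=v_0-1$, $v_3=-v_0$, $v_4=-v_1$, $v_5=-v_2$; if $\mathrm{Re}\,\tau\in\mathbb{Z}$ then $v_1=v_2$ and $v_4=v_5$ and $V$ is a rectangle. Let $m\in\{4,6\}$ be the number of distinct vertices and relabel the distinct vertices in this order as $v_0,\dots,v_{m-1}$ (indices modulo $m$); let $v_{k+1/2}$ be the midpoint of the segment from $v_k$ to $v_{k+1}$. The restricted Voronoi cell $\widetilde V$ consists of the interior of $V$, the open segments from $v_{k+1/2}$ to $v_{k+1}$ (both endpoints excluded) for all $k$, the points $v_{k+1/2}$ for $k\in\{0,\dots,\lfloor m/2\rfloor-1\}$, and the points $v_k$ for $k\in\{1,\dots,\lfloor m/3\rfloor\}$. Minimal norm representatives digit set modulo $\tau^w$: the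 set $\mathcal{D}\subseteq\mathbb{Z}[\tau]$ consisting of $0$ and of exactly one representative of each residue class of $\mathbb{Z}[\tau]$ modulo $\tau^w$ that is not divisible by $\tau$, namely the one lying in $\tau^w\widetilde V$. A multi-expansion of $z\in\mathbb{Z}[\tau]$ is a finite multiset of pairs $(d,n)\in(\mathcal{D}\setminus\{0\})\times\mathbb{N}_0$ with $\sum d\,\tau^n=z$; its weight is its cardinality counted with multiplicity. An expansion is a multi-expansion in which the exponents $n$ are pairwise distinct, identified with a finitely supported sequence $(\eta_n)_{n\in\mathbb{N}_0}\in\mathcal{D}^{\mathbb{N}_0}$ with $\sum_n\eta_n\tau^n=z$. A $w$-NAF-expansion is an expansion such that every block of $w$ consecutive digits $\eta_{j+w-1}\ldots\eta_j$ contains at most one non-zero digit. With this digit set, every element of $\mathbb{Z}[\tau]$ has exactly one $w$-NAF-expansion (a known theorem). An expansion of $z$ is optimal if its weight is at most the weight of every multi-expansion of $z$. *)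

theory Defs
  imports "HOL-Analysis.Analysis" "HOL-Library.Multiset" "HOL-Computational_Algebra.Polynomial"
begin

definition int_adjoin :: "complex \<Rightarrow> complex set" where
  "int_adjoin \<tau> = range (\<lambda>P :: int poly. poly (map_poly of_int P) \<tau>)"

definition adjoin_dvd :: "complex \<Rightarrow> complex \<Rightarrow> complex \<Rightarrow> bool" where
  "adjoin_dvd \<tau> a b \<longleftrightarrow> (\<exists>u\<in>int_adjoin \<tau>. b = a * u)"

definition voronoi_cell :: "complex \<Rightarrow> complex set" where
  "voronoi_cell \<tau> = {z. \<forall>y\<in>int_adjoin \<tau>. norm z \<le> norm (z - y)}"

(* Six points in cyclic order; the second and third, and the fifth and sixth, coincide exactly
   when Re \<tau> is an integer, and remdups_adj then leaves the four corners of a rectangle.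
   For Im \<tau> < 0 the same formulas list the vertices clockwise. *)
definition voronoi_vertices :: "complex \<Rightarrow> complex list" where
  "voronoi_vertices \<tau> =
    (let r = frac (Re \<tau>);
         t = Im \<tau>;
         v0 = Complex (1 / 2) ((t\<^sup>2 + r\<^sup>2 - r) / (2 * t));
         v1 = Complex (r - 1 / 2) ((t\<^sup>2 - r\<^sup>2 + r) / (2 * t));
         v2 = v0 - 1
     in remdups_adj [v0, v1, v2, - v0, - v1, - v2])"

definition voronoi_vertex :: "complex \<Rightarrow> nat \<Rightarrow> complex" where
  "voronoi_vertex \<tau> k = voronoi_vertices \<tau> ! (k mod length (voronoi_vertices \<tau>))"

definition voronoi_midpoint :: "complex \<Rightarrow> nat \<Rightarrow> complex" where
  "voronoi_midpoint \<tau> k = midpoint (voronoi_vertex \<tau> k) (voronoi_vertex \<tau> (k + 1))"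

definition restricted_voronoi_cell :: "complex \<Rightarrow> complex set" where
  "restricted_voronoi_cell \<tau> =
    (let m = length (voronoi_vertices \<tau>) in
       interior (voronoi_cell \<tau>)
     \<union> (\<Union>k<m. open_segment (voronoi_midpoint \<tau> k) (voronoi_vertex \<tau> (k + 1)))
     \<union> voronoi_midpoint \<tau> ` {..<m div 2}
     \<union> voronoi_vertex \<tau> ` {1..m div 3})"

definition minimal_norm_digit_set :: "complex \<Rightarrow> nat \<Rightarrow> complex set \<Rightarrow> bool" where
  "minimal_norm_digit_set \<tau> w D \<longleftrightarrow>
     0 \<in> D \<and>
     (\<forall>d\<in>D - {0}. d \<in> int_adjoin \<tau> \<and> \<not> adjoin_dvd \<tau> \<tau> d \<and>
        d \<in> (\<lambda>x. \<tau> ^ w * x) ` restricted_voronoi_cell \<tau>) \<and>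
     (\<forall>x\<in>int_adjoin \<tau>. \<not> adjoin_dvd \<tau> \<tau> x \<longrightarrow>
        (\<exists>!d. d \<in> D \<and> adjoin_dvd \<tau> (\<tau> ^ w) (d - x)))"

text \<open>The weight of a multi-expansion is its \<^const>\<open>size\<close>.\<close>

definition multi_expansion ::
    "complex \<Rightarrow> complex set \<Rightarrow> complex \<Rightarrow> (complex \<times> nat) multiset \<Rightarrow> bool" where
  "multi_expansion \<tau> D z M \<longleftrightarrow>
     set_mset M \<subseteq> (D - {0}) \<times> UNIV \<and> (\<Sum>(d, n)\<in>#M. d * \<tau> ^ n) = z"

(* The identification of a finitely supported digit sequence with the multiset of its non-zero
   digits paired with their (automatically pairwise distinct) exponents. *)
definition digit_mset :: "(nat \<Rightarrow> complex) \<Rightarrow> (complex \<times> nat) multiset" where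
  "digit_mset \<eta> = mset_set ((\<lambda>n. (\<eta> n, n)) ` {n. \<eta> n \<noteq> 0})"

definition expansion :: "complex \<Rightarrow> complex set \<Rightarrow> complex \<Rightarrow> (nat \<Rightarrow> complex) \<Rightarrow> bool" where
  "expansion \<tau> D z \<eta> \<longleftrightarrow>
     finite {n. \<eta> n \<noteq> 0} \<and> range \<eta> \<subseteq> D \<and> multi_expansion \<tau> D z (digit_mset \<eta>)"

definition wNAF_expansion ::
    "complex \<Rightarrow> nat \<Rightarrow> complex set \<Rightarrow> complex \<Rightarrow> (nat \<Rightarrow> complex) \<Rightarrow> bool" where
  "wNAF_expansion \<tau> w D z \<eta> \<longleftrightarrow>
     expansion \<tau> D z \<eta> \<and> (\<forall>j. card {n \<in> {j..<j + w}. \<eta> n \<noteq> 0} \<le> 1)"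

definition optimal_expansion ::
    "complex \<Rightarrow> complex set \<Rightarrow> complex \<Rightarrow> (nat \<Rightarrow> complex) \<Rightarrow> bool" where
  "optimal_expansion \<tau> D z \<eta> \<longleftrightarrow>
     expansion \<tau> D z \<eta> \<and>
     (\<forall>M. multi_expansion \<tau> D z M \<longrightarrow> size (digit_mset \<eta>) \<le> size M)"

end

theory Submission
  imports Defs
begin

text \<open>
  The roots in question are \<open>\<plusminus>1 \<plusminus> \<i>\<close>, so \<open>\<int>[\<tau>]\<close> is the ring of Gaussian integers and the Voronoi
  cell is the unit square around \<open>0\<close>. Multiplication by \<open>\<tau>\<close> rotates by an odd multiple of 45
  degrees, and hence so does multiplication by \<open>\<tau>\<^sup>w\<close> for odd \<open>w = 2k + 1\<close>: the scaled cell is the ball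
  of radius \<open>A = 2\<^sup>k\<close> around \<open>0\<close> in the 1-norm \<open>\<bar>Re z\<bar> + \<bar>Im z\<bar>\<close>. A Gaussian integer is divisible by \<open>\<tau>\<close>
  (is even) exactly if its 1-norm is even. As \<open>A\<close> is even, no odd element lies on the boundary of the
  ball, and the non-zero digits are precisely the odd elements of 1-norm at most \<open>A\<close>, hence at most \<open>A - 1\<close>. Since division by
  \<open>\<tau>\<close> does not increase the 1-norm, every Gaussian integer in the closed ball is \<open>0\<close> or a digit times
  a power of \<open>\<tau>\<close>; the ball thus consists of elements of weight at most one
  (lemma \<open>representable_ball\<close>). All carries below are shown to lie in this ball.

  A \<open>w\<close>-NAF arises by reading off digits: if \<open>z\<close> is even, pass to \<open>z / \<tau>\<close>; if \<open>z\<close> is odd, split off the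
  digit \<open>d\<close> congruent to \<open>z\<close> and pass to \<open>(z - d) / \<tau>\<^sup>w\<close>. Optimality follows by induction on the
  length of the \<open>w\<close>-NAF once an arbitrary multi-expansion of \<open>z\<close> can follow both steps.

  Even step (lemma \<open>representable_div_tau\<close>): the number of digits at exponent \<open>0\<close> is even, and
  adding alternately \<open>-1\<close> and \<open>1\<close> to them makes each one an even element of the ball. So \<open>z / \<tau>\<close> has
  a multi-expansion with no more digits.

  Odd step (lemma \<open>representable_remove_digit\<close>): some digit \<open>c\<close> has exponent \<open>0\<close>. Start with the
  remainder \<open>r = c\<close> and absorb the other terms one at a time. A term with exponent at least \<open>w\<close>
  is simply divided by \<open>\<tau>\<^sup>w\<close>. For a term \<open>a \<tau>\<^sup>n\<close> with \<open>n < w\<close> write \<open>r + a \<tau>\<^sup>n = s + \<tau>\<^sup>w e\<close> with \<open>s\<close> in the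
  ball. The norm estimate in lemma \<open>carry_in_ball\<close> shows that \<open>e\<close> again lies in the ball, so it costs
  one digit. In the end the remainder is an odd element of the ball congruent to \<open>z\<close>, hence equal to
  \<open>d\<close>, and \<open>(z - d) / \<tau>\<^sup>w\<close> has a multi-expansion with at least one digit fewer, because \<open>c\<close> was used up.
\<close>

section \<open>Gaussian integers and the 1-norm\<close>

definition taxi :: "complex \<Rightarrow> real" where
  "taxi z = \<bar>Re z\<bar> + \<bar>Im z\<bar>"

definition gaussian :: "complex set" where
  "gaussian = {z. Re z \<in> \<int> \<and> Im z \<in> \<int>}"

lemma taxi_triangle: "taxi (x + y) \<le> taxi x + taxi y"
  by (simp add: taxi_def)

lemma taxi_minus: "taxi (- x) = taxi x"
  by (simp add: taxi_def)

lemma taxi_triangle_minus: "taxi (x - y) \<le> taxi x + taxi y"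
  using taxi_triangle[of x "- y"] by (simp add: taxi_minus)

lemma gaussian_closed:
  "0 \<in> gaussian" "1 \<in> gaussian" "\<i> \<in> gaussian" "of_int n \<in> gaussian"
  "x \<in> gaussian \<Longrightarrow> y \<in> gaussian \<Longrightarrow> x + y \<in> gaussian"
  "x \<in> gaussian \<Longrightarrow> y \<in> gaussian \<Longrightarrow> x - y \<in> gaussian"
  "x \<in> gaussian \<Longrightarrow> - x \<in> gaussian"
  "x \<in> gaussian \<Longrightarrow> y \<in> gaussian \<Longrightarrow> x * y \<in> gaussian"
  by (auto simp: gaussian_def)

lemma gaussian_power: "x \<in> gaussian \<Longrightarrow> x ^ n \<in> gaussian"
  by (induction n) (auto intro: gaussian_closed)

lemma sum_in_gaussian: "(\<And>x. x \<in> A \<Longrightarrow> f x \<in> gaussian) \<Longrightarrow> sum f A \<in> gaussian"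
  by (induction A rule: infinite_finite_induct) (auto intro: gaussian_closed)

lemma gaussian_cases:
  assumes "z \<in> gaussian"
  obtains a b :: int where "z = Complex (of_int a) (of_int b)"
  using assms unfolding gaussian_def
  by (metis (no_types, lifting) Ints_cases complex_surj mem_Collect_eq)

lemma real_of_int_le_half:
  fixes a m :: int
  assumes "2 * \<bar>real_of_int a\<bar> \<le> 2 * of_int m + 1"
  shows "\<bar>real_of_int a\<bar> \<le> of_int m"
proof -
  have "real_of_int (2 * \<bar>a\<bar>) \<le> real_of_int (2 * m + 1)" using assms by simp
  then have "2 * \<bar>a\<bar> \<le> 2 * m + 1" by (simp only: of_int_le_iff)
  then have "\<bar>a\<bar> \<le> m" by linarith
  then show ?thesis by linarith
qed

lemma gaussian_eq_0:
  assumes "z \<in> gaussian" "\<bar>Re z\<bar> < 1" "\<bar>Im z\<bar> < 1"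
  shows "z = 0"
proof -
  obtain a b :: int where z: "z = Complex (of_int a) (of_int b)"
    using gaussian_cases[OF assms(1)] .
  from assms(2,3) have "a = 0" "b = 0" by (auto simp: z)
  then show ?thesis by (simp add: z zero_complex.code)
qed

section \<open>Multiplication by a diagonal base\<close>

text \<open>
  The base is one of \<open>\<plusminus>1 \<plusminus> \<i>\<close>, and \<open>2 k + 1\<close> is the width; \<open>k \<ge> 1\<close> makes the radius \<open>2\<^sup>k\<close> even.
\<close>

locale diagonal_base =
  fixes \<tau> :: complex and k :: nat
  assumes Re_tau: "\<bar>Re \<tau>\<bar> = 1" and Im_tau: "\<bar>Im \<tau>\<bar> = 1" and k_pos: "k \<ge> 1"
begin

lemma tau_cases:
  obtains "\<tau> = Complex 1 1" | "\<tau> = Complex 1 (-1)" | "\<tau> = Complex (-1) 1" | "\<tau> = Complex (-1) (-1)"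
proof -
  have "Re \<tau> = 1 \<or> Re \<tau> = -1" "Im \<tau> = 1 \<or> Im \<tau> = -1"
    using Re_tau Im_tau by linarith+
  then show thesis using that by (cases \<tau>) auto
qed

lemma tau_nonzero: "\<tau> \<noteq> 0"
  using Re_tau by auto

lemma tau_gaussian: "\<tau> \<in> gaussian"
  by (rule tau_cases) (auto simp: gaussian_def)

text \<open>
  The rotation by an odd multiple of 45 degrees exchanges the 1-norm and, up to a factor, the
  maximum norm. Consequently the 1-norm doubles exactly under \<open>\<tau>\<^sup>2\<close> but only grows weakly under \<open>\<tau>\<close>.
\<close>

lemma taxi_tau_mult: "taxi (\<tau> * x) = 2 * max \<bar>Re x\<bar> \<bar>Im x\<bar>"
  by (rule tau_cases) (auto simp: taxi_def)

lemma taxi_le_taxi_tau_mult: "taxi x \<le> taxi (\<tau> * x)"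
  unfolding taxi_tau_mult by (auto simp: taxi_def)

lemma norm_tau: "(norm \<tau>)\<^sup>2 = 2"
  by (rule tau_cases) (auto simp: cmod_power2)

lemma taxi_tau_power_even: "taxi (\<tau> ^ (2 * n) * x) = 2 ^ n * taxi x"
proof (induction n arbitrary: x)
  case (Suc n)
  have sq: "taxi (\<tau> * (\<tau> * y)) = 2 * taxi y" for y
    by (rule tau_cases) (auto simp: taxi_def)
  have "\<tau> ^ (2 * Suc n) * x = \<tau> ^ (2 * n) * (\<tau> * (\<tau> * x))"
    by (simp add: algebra_simps)
  then show ?case by (simp only: Suc.IH sq) simp
qed simp

lemma taxi_tau_power_odd: "taxi (\<tau> ^ (2 * k + 1) * x) = 2 ^ k * (2 * max \<bar>Re x\<bar> \<bar>Im x\<bar>)"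
proof -
  have "\<tau> ^ (2 * k + 1) * x = \<tau> ^ (2 * k) * (\<tau> * x)" by (simp add: algebra_simps)
  then show ?thesis by (simp only: taxi_tau_power_even taxi_tau_mult)
qed

lemma taxi_mult_tau_power_mono: "m \<le> n \<Longrightarrow> taxi (\<tau> ^ m * x) \<le> taxi (\<tau> ^ n * x)"
proof (induction n rule: dec_induct)
  case (step n)
  then show ?case using taxi_le_taxi_tau_mult[of "\<tau> ^ n * x"] by (simp add: mult.assoc)
qed simp

section \<open>Parity and residues\<close>

lemma radius_half: "(2::real) ^ k = 2 * of_int (2 ^ (k - 1))"
  using k_pos by (cases k) auto

lemma div_tau_gaussian_iff:
  "Complex (of_int a) (of_int b) / \<tau> \<in> gaussian \<longleftrightarrow> even (a + b)"
proof -
  have half: "(real_of_int n / 2 \<in> \<int>) \<longleftrightarrow> even n" for n :: int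
  proof
    assume "real_of_int n / 2 \<in> \<int>"
    then obtain m where "real_of_int n / 2 = of_int m" by (auto elim: Ints_cases)
    then have "real_of_int n = real_of_int (2 * m)" by simp
    then have "n = 2 * m" by (simp only: of_int_eq_iff)
    then show "even n" by simp
  next
    assume "even n"
    then obtain m where "n = 2 * m" by blast
    then show "real_of_int n / 2 \<in> \<int>" by simp
  qed
  have "Complex (of_int a) (of_int b) / \<tau> =
     Complex ((Re \<tau> * of_int a + Im \<tau> * of_int b) / 2) ((Re \<tau> * of_int b - Im \<tau> * of_int a) / 2)"
    by (rule tau_cases) (auto simp: complex_eq_iff Re_divide Im_divide)
  moreover obtain s t :: int where st: "Re \<tau> = of_int s" "Im \<tau> = of_int t" "odd s" "odd t"
    by (rule tau_cases) (auto intro: that[of 1 1] that[of 1 "-1"] that[of "-1" 1] that[of "-1" "-1"])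
  ultimately have "Complex (of_int a) (of_int b) / \<tau> =
     Complex (of_int (s * a + t * b) / 2) (of_int (s * b - t * a) / 2)" by simp
  then have "Complex (of_int a) (of_int b) / \<tau> \<in> gaussian \<longleftrightarrow> even (s * a + t * b) \<and> even (s * b - t * a)"
    by (simp only: gaussian_def mem_Collect_eq complex.sel half)
  then show ?thesis using st by auto
qed

lemma one_div_tau: "1 / \<tau> \<notin> gaussian"
  using div_tau_gaussian_iff[of 1 0] by (simp add: one_complex.code)

lemma odd_shift_div_tau:
  assumes "z \<in> gaussian" "z / \<tau> \<notin> gaussian"
  shows "(z - 1) / \<tau> \<in> gaussian" "(z + 1) / \<tau> \<in> gaussian"
proof -
  obtain a b :: int where z: "z = Complex (of_int a) (of_int b)"
    using gaussian_cases[OF assms(1)] .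
  have "odd (a + b)" using assms(2) unfolding z div_tau_gaussian_iff .
  moreover have "z - 1 = Complex (of_int (a - 1)) (of_int b)"
    "z + 1 = Complex (of_int (a + 1)) (of_int b)" by (simp_all add: z complex_eq_iff)
  ultimately show "(z - 1) / \<tau> \<in> gaussian" "(z + 1) / \<tau> \<in> gaussian"
    by (simp_all add: div_tau_gaussian_iff del: of_int_add of_int_diff)
qed

text \<open>
  The 1-norm of an odd element is an odd integer, whereas the radius is even.
\<close>

lemma odd_taxi_bound:
  assumes "z \<in> gaussian" "z / \<tau> \<notin> gaussian" "taxi z \<le> 2 ^ k"
  shows "taxi z \<le> 2 ^ k - 1"
proof -
  obtain a b :: int where z: "z = Complex (of_int a) (of_int b)"
    using gaussian_cases[OF assms(1)] .
  have odd: "odd (\<bar>a\<bar> + \<bar>b\<bar>)" using assms(2) by (simp add: z div_tau_gaussian_iff)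
  have t: "taxi z = real_of_int (\<bar>a\<bar> + \<bar>b\<bar>)" by (simp add: z taxi_def)
  have "real_of_int (\<bar>a\<bar> + \<bar>b\<bar>) \<le> real_of_int (2 ^ k)" using assms(3) t by simp
  then have "\<bar>a\<bar> + \<bar>b\<bar> \<le> 2 ^ k" by (simp only: of_int_le_iff)
  moreover have "even ((2::int) ^ k)" using k_pos by simp
  ultimately have "\<bar>a\<bar> + \<bar>b\<bar> \<le> 2 ^ k - 1" using odd by (cases "\<bar>a\<bar> + \<bar>b\<bar> = 2 ^ k") auto
  then have "real_of_int (\<bar>a\<bar> + \<bar>b\<bar>) \<le> real_of_int (2 ^ k - 1)" by (simp only: of_int_le_iff)
  then show ?thesis using t by simp
qed

text \<open>
  The closed ball contains a representative of every residue class modulo \<open>\<tau>\<^sup>w\<close>: rounding both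
  coordinates of \<open>g / \<tau>\<^sup>w\<close> leaves an error in the unit square, which \<open>\<tau>\<^sup>w\<close> maps into the ball.
\<close>

lemma residue_in_ball:
  assumes "g \<in> gaussian"
  obtains e where "e \<in> gaussian" "taxi (g - \<tau> ^ (2 * k + 1) * e) \<le> 2 ^ k"
proof -
  define q where "q = g / \<tau> ^ (2 * k + 1)"
  define e where "e = Complex (of_int (round (Re q))) (of_int (round (Im q)))"
  have q: "g = \<tau> ^ (2 * k + 1) * q" using tau_nonzero by (simp add: q_def)
  have "\<bar>Re (q - e)\<bar> \<le> 1 / 2" "\<bar>Im (q - e)\<bar> \<le> 1 / 2"
    using of_int_round_abs_le[of "Re q"] of_int_round_abs_le[of "Im q"]
    by (simp_all add: e_def abs_minus_commute)
  then have "2 * max \<bar>Re (q - e)\<bar> \<bar>Im (q - e)\<bar> \<le> 1" by simp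
  then have "2 ^ k * (2 * max \<bar>Re (q - e)\<bar> \<bar>Im (q - e)\<bar>) \<le> 2 ^ k * (1::real)"
    by (intro mult_left_mono) simp_all
  then have "taxi (\<tau> ^ (2 * k + 1) * (q - e)) \<le> 2 ^ k"
    unfolding taxi_tau_power_odd by simp
  then have "taxi (g - \<tau> ^ (2 * k + 1) * e) \<le> 2 ^ k"
    by (subst q) (simp only: right_diff_distrib)
  moreover have "e \<in> gaussian" by (simp add: e_def gaussian_def)
  ultimately show thesis using that by blast
qed

text \<open>
  The difference of two odd elements of the ball is too short to be a non-zero multiple of \<open>\<tau>\<^sup>w\<close>.
  This fails for even elements, which may lie on the boundary.
\<close>

lemma odd_residue_unique:
  assumes "r \<in> gaussian" "r / \<tau> \<notin> gaussian" "taxi r \<le> 2 ^ k"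
    and "s \<in> gaussian" "s / \<tau> \<notin> gaussian" "taxi s \<le> 2 ^ k"
    and "e \<in> gaussian" "r - s = \<tau> ^ (2 * k + 1) * e"
  shows "e = 0"
proof -
  have "taxi (\<tau> ^ (2 * k + 1) * e) < 2 * 2 ^ k"
    using taxi_triangle_minus[of r s] odd_taxi_bound[OF assms(1-3)] odd_taxi_bound[OF assms(4-6)]
      assms(8) by simp
  then have "max \<bar>Re e\<bar> \<bar>Im e\<bar> < 1" unfolding taxi_tau_power_odd by simp
  then show ?thesis using gaussian_eq_0[OF assms(7)] by simp
qed

text \<open>
  The key estimate, with \<open>A = 2\<^sup>k\<close>. Monotonicity in the exponent reduces the term \<open>c \<tau>\<^sup>n\<close> to the case
  \<open>n = w - 1\<close>, where its 1-norm is at most \<open>A (A - 1)\<close>. Together with the two remainders this gives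
  \<open>A (A + 1)\<close> for \<open>\<tau>\<^sup>w e\<close>, that is \<open>(A + 1) / 2\<close> for the maximum norm of \<open>e\<close>. The coordinates of \<open>e\<close>
  are integers and \<open>A\<close> is even, so both are at most \<open>A / 2\<close> in absolute value, and their sum is at most
  \<open>A\<close>.
\<close>

lemma carry_in_ball:
  assumes "taxi r \<le> 2 ^ k" "taxi s \<le> 2 ^ k" "taxi c \<le> 2 ^ k - 1" "n < 2 * k + 1"
    and "e \<in> gaussian" "r + c * \<tau> ^ n = s + \<tau> ^ (2 * k + 1) * e"
  shows "taxi e \<le> 2 ^ k"
proof -
  have "taxi (\<tau> ^ n * c) \<le> taxi (\<tau> ^ (2 * k) * c)"
    using assms(4) by (intro taxi_mult_tau_power_mono) simp
  also have "\<dots> \<le> 2 ^ k * (2 ^ k - 1)"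
    unfolding taxi_tau_power_even using assms(3) by (intro mult_left_mono) simp_all
  finally have x: "taxi (\<tau> ^ n * c) \<le> 2 ^ k * (2 ^ k - 1)" .
  have "\<tau> ^ (2 * k + 1) * e = (r - s) + \<tau> ^ n * c"
    using assms(6) by (simp add: algebra_simps)
  then have "taxi (\<tau> ^ (2 * k + 1) * e) \<le> taxi r + taxi s + taxi (\<tau> ^ n * c)"
    using taxi_triangle[of "r - s" "\<tau> ^ n * c"] taxi_triangle_minus[of r s] by simp
  also have "\<dots> \<le> 2 ^ k * (2 ^ k + 1)" using x assms(1,2) by (simp add: algebra_simps)
  finally have m: "2 * max \<bar>Re e\<bar> \<bar>Im e\<bar> \<le> 2 ^ k + 1" unfolding taxi_tau_power_odd by simp
  obtain a b :: int where e: "e = Complex (of_int a) (of_int b)"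
    using gaussian_cases[OF assms(5)] .
  have "\<bar>real_of_int a\<bar> \<le> of_int (2 ^ (k - 1))" "\<bar>real_of_int b\<bar> \<le> of_int (2 ^ (k - 1))"
    by (rule real_of_int_le_half, use m radius_half in \<open>simp add: e\<close>)+
  then show ?thesis using radius_half by (simp add: e taxi_def)
qed

section \<open>The Voronoi cell and the digits\<close>

lemma int_adjoin_eq: "int_adjoin \<tau> = gaussian"
proof
  have "poly (map_poly of_int P) \<tau> \<in> gaussian" for P :: "int poly"
    by (induction P) (auto simp: map_poly_pCons intro!: gaussian_closed tau_gaussian)
  then show "int_adjoin \<tau> \<subseteq> gaussian" by (auto simp: int_adjoin_def)
next
  show "gaussian \<subseteq> int_adjoin \<tau>"
  proof
    fix z assume "z \<in> gaussian"
    then obtain a b :: int where z: "z = Complex (of_int a) (of_int b)"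
      using gaussian_cases by blast
    have lin: "of_int m + of_int n * \<tau> \<in> int_adjoin \<tau>" for m n :: int
      unfolding int_adjoin_def
      by (rule range_eqI[of _ _ "[:m, n:]"]) (simp add: map_poly_pCons mult.commute)
    show "z \<in> int_adjoin \<tau>"
    proof (rule tau_cases)
      assume "\<tau> = Complex 1 1"
      then have "z = of_int (a - b) + of_int b * \<tau>" by (simp add: z complex_eq_iff)
      then show ?thesis using lin by metis
    next
      assume "\<tau> = Complex 1 (-1)"
      then have "z = of_int (a + b) + of_int (- b) * \<tau>" by (simp add: z complex_eq_iff)
      then show ?thesis using lin by metis
    next
      assume "\<tau> = Complex (-1) 1"
      then have "z = of_int (a + b) + of_int b * \<tau>" by (simp add: z complex_eq_iff)
      then show ?thesis using lin by metis
    next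
      assume "\<tau> = Complex (-1) (-1)"
      then have "z = of_int (a - b) + of_int (- b) * \<tau>" by (simp add: z complex_eq_iff)
      then show ?thesis using lin by metis
    qed
  qed
qed

lemma adjoin_dvd_tau_iff: "adjoin_dvd \<tau> \<tau> z \<longleftrightarrow> z / \<tau> \<in> gaussian"
  unfolding adjoin_dvd_def int_adjoin_eq
  by (metis nonzero_mult_div_cancel_left tau_nonzero nonzero_eq_divide_eq mult.commute)

text \<open>
  Comparing distances to \<open>0\<close> and to \<open>\<plusminus>1\<close>, \<open>\<plusminus>\<i>\<close> puts the cell inside the unit square; convexity takes
  care of the segments between the listed vertices.
\<close>

lemma restricted_voronoi_cell_bound:
  assumes "x \<in> restricted_voronoi_cell \<tau>"
  shows "max \<bar>Re x\<bar> \<bar>Im x\<bar> \<le> 1 / 2"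
proof -
  define B where "B = cbox (Complex (-1/2) (-1/2)) (Complex (1/2) (1/2))"
  have B: "x \<in> B \<longleftrightarrow> \<bar>Re x\<bar> \<le> 1/2 \<and> \<bar>Im x\<bar> \<le> 1/2" for x
    by (auto simp: B_def in_cbox_complex_iff)
  have conv: "convex B" by (simp add: B_def)
  have cell: "voronoi_cell \<tau> \<subseteq> B"
  proof
    fix x assume x: "x \<in> voronoi_cell \<tau>"
    have le: "(norm x)\<^sup>2 \<le> (norm (x - y))\<^sup>2" if "y \<in> gaussian" for y
      using x that by (auto simp: voronoi_cell_def int_adjoin_eq intro: power_mono)
    have "1 \<in> gaussian" "-1 \<in> gaussian" "\<i> \<in> gaussian" "-\<i> \<in> gaussian"
      by (auto intro: gaussian_closed)
    from this[THEN le] show "x \<in> B"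
      unfolding B cmod_power2 by (simp add: power2_eq_square algebra_simps) linarith
  qed
  have ne: "voronoi_vertices \<tau> \<noteq> []"
    unfolding voronoi_vertices_def Let_def remdups_adj_Nil_iff by simp
  have fr: "frac (Re \<tau>) = 0" by (rule tau_cases) auto
  have "set (voronoi_vertices \<tau>) \<subseteq> B"
    unfolding voronoi_vertices_def Let_def remdups_adj_set fr
    by (rule tau_cases) (simp_all add: B)
  then have v: "voronoi_vertex \<tau> i \<in> B" for i
    unfolding voronoi_vertex_def using ne by (meson length_greater_0_conv mod_less_divisor nth_mem subsetD)
  have m: "voronoi_midpoint \<tau> i \<in> B" for i
    unfolding voronoi_midpoint_def
    using closed_segment_subset[OF v v conv] midpoint_in_closed_segment by blast
  have s: "open_segment (voronoi_midpoint \<tau> i) (voronoi_vertex \<tau> j) \<subseteq> B" for i j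
    using closed_segment_subset[OF m v conv] segment_open_subset_closed by blast
  have "x \<in> B"
    using assms cell interior_subset s m v unfolding restricted_voronoi_cell_def Let_def by blast
  then have "\<bar>Re x\<bar> \<le> 1 / 2" "\<bar>Im x\<bar> \<le> 1 / 2" unfolding B by blast+
  then show ?thesis by (rule max.boundedI)
qed

end

locale diagonal_digits = diagonal_base +
  fixes D :: "complex set"
  assumes digits: "minimal_norm_digit_set \<tau> (2 * k + 1) D"
begin

lemma digitD:
  assumes "d \<in> D" "d \<noteq> 0"
  shows "d \<in> gaussian" "d / \<tau> \<notin> gaussian" "taxi d \<le> 2 ^ k - 1"
proof -
  have d: "d \<in> gaussian \<and> d / \<tau> \<notin> gaussian \<and>
      d \<in> (\<lambda>x. \<tau> ^ (2 * k + 1) * x) ` restricted_voronoi_cell \<tau>"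
    using digits assms
    unfolding minimal_norm_digit_set_def int_adjoin_eq adjoin_dvd_tau_iff by blast
  then obtain x where x: "x \<in> restricted_voronoi_cell \<tau>" "d = \<tau> ^ (2 * k + 1) * x" by blast
  have "2 ^ k * (2 * max \<bar>Re x\<bar> \<bar>Im x\<bar>) \<le> 2 ^ k * (1::real)"
    using restricted_voronoi_cell_bound[OF x(1)] by (intro mult_left_mono) simp_all
  then have "taxi d \<le> 2 ^ k" unfolding x(2) taxi_tau_power_odd by simp
  with d show "d \<in> gaussian" "d / \<tau> \<notin> gaussian" "taxi d \<le> 2 ^ k - 1"
    using odd_taxi_bound by blast+
qed

text \<open>
  Converse of \<open>digitD\<close>: the digit representing the class of \<open>z\<close> is an odd element of the ball
  congruent to \<open>z\<close>, so it is \<open>z\<close> itself.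
\<close>

lemma odd_in_ball_digit:
  assumes "z \<in> gaussian" "z / \<tau> \<notin> gaussian" "taxi z \<le> 2 ^ k"
  shows "z \<in> D - {0}"
proof -
  obtain d where d: "d \<in> D" "adjoin_dvd \<tau> (\<tau> ^ (2 * k + 1)) (d - z)"
    using digits assms unfolding minimal_norm_digit_set_def int_adjoin_eq adjoin_dvd_tau_iff
    by blast
  then obtain e where e: "e \<in> gaussian" "d - z = \<tau> ^ (2 * k + 1) * e"
    by (auto simp: adjoin_dvd_def int_adjoin_eq)
  have "d \<noteq> 0"
  proof
    assume "d = 0"
    then have "z = \<tau> * (- (\<tau> ^ (2 * k) * e))"
      using e(2)
      by (metis diff_0 minus_minus mult_minus_right mult.assoc power_add power_one_right mult.commute)
    then have "z / \<tau> = - (\<tau> ^ (2 * k) * e)"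
      by (simp only: nonzero_mult_div_cancel_left[OF tau_nonzero])
    then show False using assms(2) e(1) tau_gaussian
      by (auto intro: gaussian_closed gaussian_power)
  qed
  then have "e = 0" using odd_residue_unique[OF _ _ _ assms e] digitD[OF d(1)] by simp
  then show ?thesis using e d(1) \<open>d \<noteq> 0\<close> by simp
qed

section \<open>Weights of multi-expansions\<close>

definition representable :: "nat \<Rightarrow> complex \<Rightarrow> bool" where
  "representable n z \<longleftrightarrow> (\<exists>M. multi_expansion \<tau> D z M \<and> size M \<le> n)"

lemma representable_0: "representable n 0"
  unfolding representable_def by (rule exI[of _ "{#}"]) (simp add: multi_expansion_def)

lemma representable_digit: "d \<in> D - {0} \<Longrightarrow> representable 1 (d * \<tau> ^ n)"
  unfolding representable_def by (rule exI[of _ "{#(d, n)#}"]) (simp add: multi_expansion_def)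

lemma representable_add:
  "representable m x \<Longrightarrow> representable n y \<Longrightarrow> representable (m + n) (x + y)"
  unfolding representable_def multi_expansion_def
  by (elim exE conjE, rule_tac x = "M + Ma" in exI) auto

lemma representable_tau_mult:
  assumes "representable n x"
  shows "representable n (\<tau> * x)"
proof -
  obtain M where M: "multi_expansion \<tau> D x M" "size M \<le> n"
    using assms by (auto simp: representable_def)
  have "multi_expansion \<tau> D (\<tau> * x) (image_mset (map_prod id Suc) M)"
    using M(1) unfolding multi_expansion_def
    by (auto simp: image_mset.compositionality o_def case_prod_unfold sum_mset_distrib_left
        algebra_simps)
  then show ?thesis using M(2) by (auto simp: representable_def intro!: exI)
qed

text \<open>
  Dividing by \<open>\<tau>\<close> keeps an even element in the ball and halves its squared Euclidean norm, so after
  finitely many divisions the element is \<open>0\<close> or odd, and an odd one is a digit.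
\<close>

lemma representable_ball:
  assumes "z \<in> gaussian" "taxi z \<le> 2 ^ k"
  shows "representable 1 z"
proof -
  have "z \<in> gaussian \<Longrightarrow> taxi z \<le> 2 ^ k \<Longrightarrow> (norm z)\<^sup>2 < 2 ^ n \<Longrightarrow> representable 1 z" for n
  proof (induction n arbitrary: z)
    case 0
    have "\<bar>Re z\<bar> < 1" "\<bar>Im z\<bar> < 1"
      using 0(3) abs_Re_le_cmod[of z] abs_Im_le_cmod[of z] by (auto simp: power2_less_1_iff abs_square_less_1)
    then show ?case using gaussian_eq_0[OF 0(1)] representable_0 by simp
  next
    case (Suc n)
    show ?case
    proof (cases "z / \<tau> \<in> gaussian")
      case True
      have z: "z = \<tau> * (z / \<tau>)" using tau_nonzero by simp
      have "representable 1 (z / \<tau>)"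
      proof (rule Suc.IH[OF True])
        show "taxi (z / \<tau>) \<le> 2 ^ k"
          using taxi_le_taxi_tau_mult[of "z / \<tau>"] Suc.prems(2) z by simp
        show "(norm (z / \<tau>))\<^sup>2 < 2 ^ n"
          using Suc.prems(3) by (simp add: norm_divide power_divide norm_tau)
      qed
      then show ?thesis using representable_tau_mult z by metis
    next
      case False
      then show ?thesis using odd_in_ball_digit[OF Suc.prems(1) False Suc.prems(2)]
          representable_digit[of z 0] by simp
    qed
  qed
  moreover obtain n where "(norm z)\<^sup>2 < 2 ^ n"
    using real_arch_pow[of 2 "(norm z)\<^sup>2"] by auto
  ultimately show ?thesis using assms by blast
qed

section \<open>Dividing a multi-expansion by the base\<close>

text \<open>
  The remainder \<open>\<epsilon>\<close> records the parity of the number of digits at exponent \<open>0\<close> met so far. An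
  odd digit \<open>c\<close> flips it from \<open>0\<close> to \<open>1\<close> by \<open>c = 1 + (c - 1)\<close>, and from \<open>1\<close> to \<open>0\<close> by forming \<open>1 + c\<close>.
  In both cases the element divided by \<open>\<tau>\<close> stays in the ball because \<open>c\<close> has 1-norm at most
  \<open>2\<^sup>k - 1\<close>.
\<close>

lemma carry_tau:
  assumes "set_mset M \<subseteq> (D - {0}) \<times> UNIV"
  shows "\<exists>\<epsilon> y. \<epsilon> \<in> {0, 1} \<and> (\<Sum>(d, n)\<in>#M. d * \<tau> ^ n) = \<epsilon> + \<tau> * y \<and>
    y \<in> gaussian \<and> representable (size M) y"
  using assms
proof (induction M)
  case empty
  show ?case by (rule exI[of _ 0], rule exI[of _ 0]) (simp add: representable_0 gaussian_closed)
next
  case (add p M)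
  obtain c n where p: "p = (c, n)" by fastforce
  from add.prems p have c: "c \<in> D - {0}" and "set_mset M \<subseteq> (D - {0}) \<times> UNIV" by auto
  then obtain \<epsilon> y where IH: "\<epsilon> \<in> {0, 1}" "(\<Sum>(d, n)\<in>#M. d * \<tau> ^ n) = \<epsilon> + \<tau> * y"
    "y \<in> gaussian" "representable (size M) y" using add.IH by blast
  have ext: ?case if "\<epsilon>' \<in> {0, 1}" "c * \<tau> ^ n + \<epsilon> = \<epsilon>' + \<tau> * e" "e \<in> gaussian" "representable 1 e"
    for \<epsilon>' e
  proof (intro exI conjI)
    show "\<epsilon>' \<in> {0, 1}" by fact
    show "(\<Sum>(d, n)\<in>#add_mset p M. d * \<tau> ^ n) = \<epsilon>' + \<tau> * (y + e)"
      using that(2) by (simp add: p IH(2) algebra_simps)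
    show "y + e \<in> gaussian" using that IH by (intro gaussian_closed)
    show "representable (size (add_mset p M)) (y + e)"
      using representable_add[OF IH(4) that(4)] by simp
  qed
  have dig: "c \<in> gaussian" "c / \<tau> \<notin> gaussian" "taxi c \<le> 2 ^ k - 1"
    using digitD[of c] c by auto
  have even: "representable 1 (x / \<tau>)" if "x / \<tau> \<in> gaussian" "taxi x \<le> 2 ^ k" for x
    using taxi_le_taxi_tau_mult[of "x / \<tau>"] that tau_nonzero
    by (intro representable_ball) simp_all
  show ?case
  proof (cases n)
    case (Suc n')
    show ?thesis
      by (rule ext[of \<epsilon> "c * \<tau> ^ n'"])
        (use IH Suc dig c representable_digit[OF c] tau_gaussian in
          \<open>auto simp: algebra_simps intro: gaussian_closed gaussian_power\<close>)
  next
    case 0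
    show ?thesis
    proof (cases "\<epsilon> = 0")
      case True
      have "taxi (c - 1) \<le> 2 ^ k"
        using taxi_triangle_minus[of c 1] dig by (simp add: taxi_def)
      then show ?thesis
        using ext[of 1 "(c - 1) / \<tau>"] odd_shift_div_tau[OF dig(1,2)] even tau_nonzero 0 True
        by simp
    next
      case False
      have "taxi (c + 1) \<le> 2 ^ k"
        using taxi_triangle[of c 1] dig by (simp add: taxi_def)
      then show ?thesis
        using ext[of 0 "(c + 1) / \<tau>"] odd_shift_div_tau[OF dig(1,2)] even tau_nonzero 0 False IH(1)
        by simp
    qed
  qed
qed

lemma representable_div_tau:
  assumes "multi_expansion \<tau> D (\<tau> * z) M" "z \<in> gaussian"
  shows "representable (size M) z"
proof -
  obtain \<epsilon> y where y: "\<epsilon> \<in> {0, 1}" "\<tau> * z = \<epsilon> + \<tau> * y" "y \<in> gaussian" "representable (size M) y"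
    using carry_tau[of M] assms by (auto simp: multi_expansion_def)
  have "\<epsilon> / \<tau> = z - y" using y(2) tau_nonzero by (simp add: field_simps)
  then have "\<epsilon> / \<tau> \<in> gaussian" using assms(2) y(3) by (simp add: gaussian_closed)
  then have "\<epsilon> = 0" using y(1) one_div_tau by auto
  then show ?thesis using y tau_nonzero by simp
qed

section \<open>Removing the lowest digit of a multi-expansion\<close>

text \<open>
  Each term of \<open>M\<close> contributes at most one term to \<open>y\<close>, either its own quotient by \<open>\<tau>\<^sup>w\<close> or the carry
  that it causes. The start value \<open>c\<close> contributes nothing, which is where a digit is saved.
\<close>

lemma carry_tau_power:
  assumes "set_mset M \<subseteq> (D - {0}) \<times> UNIV" "c \<in> gaussian" "taxi c \<le> 2 ^ k"
  shows "\<exists>r y. r \<in> gaussian \<and> taxi r \<le> 2 ^ k \<and> y \<in> gaussian \<and> representable (size M) y \<and>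
    c + (\<Sum>(d, n)\<in>#M. d * \<tau> ^ n) = r + \<tau> ^ (2 * k + 1) * y"
  using assms(1)
proof (induction M)
  case empty
  show ?case
    by (rule exI[of _ c], rule exI[of _ 0]) (use assms in \<open>simp add: representable_0 gaussian_closed\<close>)
next
  case (add p M)
  obtain a n where p: "p = (a, n)" by fastforce
  from add.prems p have a: "a \<in> D - {0}" and "set_mset M \<subseteq> (D - {0}) \<times> UNIV" by auto
  then obtain r y where IH: "r \<in> gaussian" "taxi r \<le> 2 ^ k" "y \<in> gaussian" "representable (size M) y"
    "c + (\<Sum>(d, n)\<in>#M. d * \<tau> ^ n) = r + \<tau> ^ (2 * k + 1) * y" using add.IH by blast
  have ext: ?case if "s \<in> gaussian" "taxi s \<le> 2 ^ k" "e \<in> gaussian" "representable 1 e"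
    "r + a * \<tau> ^ n = s + \<tau> ^ (2 * k + 1) * e" for s e
  proof (intro exI conjI)
    have "c + (\<Sum>(d, n)\<in>#add_mset p M. d * \<tau> ^ n) =
        a * \<tau> ^ n + (c + (\<Sum>(d, n)\<in>#M. d * \<tau> ^ n))" by (simp add: p)
    also have "\<dots> = (r + a * \<tau> ^ n) + \<tau> ^ (2 * k + 1) * y" by (simp only: IH(5) add_ac)
    also have "\<dots> = s + \<tau> ^ (2 * k + 1) * (y + e)"
      by (simp only: that(5) distrib_left add_ac)
    finally show "c + (\<Sum>(d, n)\<in>#add_mset p M. d * \<tau> ^ n) = s + \<tau> ^ (2 * k + 1) * (y + e)" .
    show "representable (size (add_mset p M)) (y + e)"
      using representable_add[OF IH(4) that(4)] by simp
  qed (use that IH in \<open>auto intro: gaussian_closed\<close>)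
  have dig: "a \<in> gaussian" "taxi a \<le> 2 ^ k - 1" using digitD[of a] a by auto
  show ?case
  proof (cases "n < 2 * k + 1")
    case True
    have g: "r + a * \<tau> ^ n \<in> gaussian"
      using IH dig tau_gaussian by (intro gaussian_closed gaussian_power)
    then obtain e where e: "e \<in> gaussian" "taxi (r + a * \<tau> ^ n - \<tau> ^ (2 * k + 1) * e) \<le> 2 ^ k"
      using residue_in_ball by blast
    have s: "r + a * \<tau> ^ n - \<tau> ^ (2 * k + 1) * e \<in> gaussian"
      by (intro gaussian_closed(6)[OF g] gaussian_closed(8)[OF _ e(1)] gaussian_power tau_gaussian)
    have "taxi e \<le> 2 ^ k" using carry_in_ball[OF IH(2) e(2) dig(2) True e(1)] by simp
    then show ?thesis using ext[OF s e(2,1)] representable_ball[OF e(1)] by simp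
  next
    case False
    have "a * \<tau> ^ n = \<tau> ^ (2 * k + 1) * (a * \<tau> ^ (n - (2 * k + 1)))"
      using False by (simp flip: power_add power_Suc add: mult.left_commute)
    moreover have "a * \<tau> ^ (n - (2 * k + 1)) \<in> gaussian"
      using dig tau_gaussian by (intro gaussian_closed gaussian_power)
    ultimately show ?thesis using ext[OF IH(1,2)] representable_digit[OF a] by simp
  qed
qed

text \<open>
  A sum of terms with positive exponents only is divisible by \<open>\<tau>\<close>.
\<close>

lemma odd_multi_expansion_low_digit:
  assumes "multi_expansion \<tau> D z M" "z / \<tau> \<notin> gaussian"
  obtains c N where "M = add_mset (c, 0) N"
proof (rule ccontr)
  assume "\<not> thesis"
  then have no: "(c, 0) \<notin># M" for c using that by (metis mset_add)
  have "set_mset N \<subseteq> set_mset M \<Longrightarrow> (\<Sum>(d, n)\<in>#N. d * \<tau> ^ n) / \<tau> \<in> gaussian" for N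
  proof (induction N)
    case empty
    then show ?case by (simp add: gaussian_closed)
  next
    case (add p N)
    obtain c n where p: "p = (c, n)" by fastforce
    from add.prems p have m: "(c, n) \<in># M" by simp
    with no obtain n' where n: "n = Suc n'" by (cases n) auto
    have "c \<in> gaussian" using m assms(1) digitD(1) by (auto simp: multi_expansion_def)
    moreover have "(\<Sum>(d, n)\<in>#add_mset p N. d * \<tau> ^ n) / \<tau> =
        c * \<tau> ^ n' + (\<Sum>(d, n)\<in>#N. d * \<tau> ^ n) / \<tau>"
      using tau_nonzero by (simp add: p n field_simps)
    ultimately show ?case using add tau_gaussian by (auto intro!: gaussian_closed gaussian_power)
  qed
  then show False using assms by (auto simp: multi_expansion_def)
qed

lemma representable_remove_digit:
  assumes "multi_expansion \<tau> D (d + \<tau> ^ (2 * k + 1) * z) M" "d \<in> D - {0}" "z \<in> gaussian"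
  obtains m where "size M = Suc m" "representable m z"
proof -
  have d: "d \<in> gaussian" "d / \<tau> \<notin> gaussian" "taxi d \<le> 2 ^ k" using digitD[of d] assms(2) by auto
  have shift: "(x + \<tau> ^ (2 * k + 1) * y) / \<tau> \<in> gaussian \<longleftrightarrow> x / \<tau> \<in> gaussian"
    if "y \<in> gaussian" for x y
  proof -
    have "(x + \<tau> ^ (2 * k + 1) * y) / \<tau> = x / \<tau> + \<tau> ^ (2 * k) * y"
      using tau_nonzero by (simp add: field_simps)
    moreover have "\<tau> ^ (2 * k) * y \<in> gaussian"
      using that tau_gaussian by (intro gaussian_closed gaussian_power)
    ultimately show ?thesis by (metis add_diff_cancel_right' gaussian_closed(5,6))
  qed
  have "(d + \<tau> ^ (2 * k + 1) * z) / \<tau> \<notin> gaussian" using shift[OF assms(3)] d by blast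
  then obtain c N where M: "M = add_mset (c, 0) N"
    using odd_multi_expansion_low_digit[OF assms(1)] by blast
  have "c \<in> D - {0}" and N: "set_mset N \<subseteq> (D - {0}) \<times> UNIV"
    using assms(1) by (auto simp: M multi_expansion_def)
  then have c: "c \<in> gaussian" "taxi c \<le> 2 ^ k" using digitD[of c] by auto
  obtain r y where r: "r \<in> gaussian" "taxi r \<le> 2 ^ k" "y \<in> gaussian" "representable (size N) y"
    "c + (\<Sum>(d, n)\<in>#N. d * \<tau> ^ n) = r + \<tau> ^ (2 * k + 1) * y"
    using carry_tau_power[OF N c] by blast
  have eq: "d + \<tau> ^ (2 * k + 1) * z = r + \<tau> ^ (2 * k + 1) * y"
    using assms(1) r(5) by (simp add: M multi_expansion_def)
  then have "r / \<tau> \<notin> gaussian" using shift[OF assms(3)] shift[OF r(3)] d by metis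
  moreover have "d - r = \<tau> ^ (2 * k + 1) * (y - z)"
  proof -
    have "\<tau> ^ (2 * k + 1) * y = d + \<tau> ^ (2 * k + 1) * z - r" unfolding eq by simp
    then show ?thesis unfolding right_diff_distrib by simp
  qed
  moreover have "y - z \<in> gaussian" using r assms by (intro gaussian_closed)
  ultimately have "y - z = 0" using odd_residue_unique d r by blast
  then show thesis using that[of "size N"] r M by simp
qed

section \<open>Optimality of the non-adjacent form\<close>

lemma digit_shift:
  fixes \<eta> :: "nat \<Rightarrow> complex"
  assumes "\<And>n. 0 < n \<Longrightarrow> n < s \<Longrightarrow> \<eta> n = 0" "0 < s" "0 < N" "\<And>n. N \<le> n \<Longrightarrow> \<eta> n = 0"
  shows "(\<Sum>n<N. \<eta> n * \<tau> ^ n) = \<eta> 0 + \<tau> ^ s * (\<Sum>n<N - s. \<eta> (s + n) * \<tau> ^ n)"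
    and "card {n. \<eta> n \<noteq> 0} = (if \<eta> 0 = 0 then 0 else 1) + card {n. \<eta> (s + n) \<noteq> 0}"
proof -
  have "(\<Sum>n<N. \<eta> n * \<tau> ^ n) = (\<Sum>n\<in>insert 0 {s..<N}. \<eta> n * \<tau> ^ n)"
  proof (intro sum.mono_neutral_right ballI)
    fix n assume "n \<in> {..<N} - insert 0 {s..<N}"
    then show "\<eta> n * \<tau> ^ n = 0" using assms(1)[of n] by auto
  qed (use assms(3) in auto)
  also have "\<dots> = \<eta> 0 + (\<Sum>n\<in>{s..<N}. \<eta> n * \<tau> ^ n)" using assms(2) by simp
  also have "(\<Sum>n\<in>{s..<N}. \<eta> n * \<tau> ^ n) = \<tau> ^ s * (\<Sum>n<N - s. \<eta> (s + n) * \<tau> ^ n)"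
    by (subst sum.atLeastLessThan_shift_0)
      (simp add: sum_distrib_left power_add mult_ac atLeast0LessThan)
  finally show "(\<Sum>n<N. \<eta> n * \<tau> ^ n) = \<eta> 0 + \<tau> ^ s * (\<Sum>n<N - s. \<eta> (s + n) * \<tau> ^ n)" .
  have fin: "finite {n. \<eta> (s + n) \<noteq> 0}"
  proof (rule finite_subset)
    show "{n. \<eta> (s + n) \<noteq> 0} \<subseteq> {..<N}"
    proof
      fix n assume "n \<in> {n. \<eta> (s + n) \<noteq> 0}"
      then show "n \<in> {..<N}" using assms(4)[of "s + n"] by (cases "n < N") auto
    qed
  qed simp
  have "{n. \<eta> n \<noteq> 0} = (if \<eta> 0 = 0 then {} else {0}) \<union> (+) s ` {n. \<eta> (s + n) \<noteq> 0}"
  proof (intro set_eqI iffI)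
    fix n assume n: "n \<in> {n. \<eta> n \<noteq> 0}"
    show "n \<in> (if \<eta> 0 = 0 then {} else {0}) \<union> (+) s ` {n. \<eta> (s + n) \<noteq> 0}"
    proof (cases "n = 0")
      case False
      with n assms(1)[of n] have "s \<le> n" by (auto simp: not_less[symmetric])
      then obtain l where "n = s + l" using le_Suc_ex by blast
      then show ?thesis using n by auto
    qed (use n in auto)
  qed (auto split: if_splits)
  then show "card {n. \<eta> n \<noteq> 0} = (if \<eta> 0 = 0 then 0 else 1) + card {n. \<eta> (s + n) \<noteq> 0}"
    using assms(2) fin by (auto simp: card_image card_insert_if image_iff)
qed

text \<open>
  Induction on the length \<open>N\<close> of the expansion. A shifted \<open>w\<close>-NAF is again a
  \<open>w\<close>-NAF, now of the quotient for which the even or odd step provides a short multi-expansion.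
\<close>

lemma wNAF_weight_le:
  assumes "range \<eta> \<subseteq> D" "\<And>n. N \<le> n \<Longrightarrow> \<eta> n = 0"
    and "\<And>j. card {n \<in> {j..<j + (2 * k + 1)}. \<eta> n \<noteq> 0} \<le> 1"
    and "multi_expansion \<tau> D (\<Sum>n<N. \<eta> n * \<tau> ^ n) M"
  shows "card {n. \<eta> n \<noteq> 0} \<le> size M"
  using assms
proof (induction N arbitrary: \<eta> M rule: less_induct)
  case (less N)
  \<comment> \<open>The number of positions consumed: the non-adjacency condition forces \<open>2 k\<close> zeros after a
    non-zero lowest digit.\<close>
  define s where "s = (if \<eta> 0 = 0 then 1 else 2 * k + 1)"
  define z where "z = (\<Sum>n<N - s. \<eta> (s + n) * \<tau> ^ n)"
  show ?case
  proof (cases "N = 0")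
    case True
    then show ?thesis using less.prems(2) by simp
  next
    case False
    have gap: "\<eta> n = 0" if "0 < n" "n < s" for n
    proof (rule ccontr)
      assume "\<eta> n \<noteq> 0"
      then have "{0, n} \<subseteq> {n \<in> {0..<0 + (2 * k + 1)}. \<eta> n \<noteq> 0}"
        using that by (auto simp: s_def split: if_splits)
      then have "card {0, n} \<le> card {n \<in> {0..<0 + (2 * k + 1)}. \<eta> n \<noteq> 0}"
        by (intro card_mono) auto
      then show False using less.prems(3)[of 0] that by simp
    qed
    have s: "0 < s" "N - s < N" using False by (auto simp: s_def)
    note shift = digit_shift[of s \<eta> N, OF gap s(1) _ less.prems(2), folded z_def]
    have "\<eta> n \<in> gaussian" for n
      using digitD(1)[of "\<eta> n"] less.prems(1) by (cases "\<eta> n = 0") (auto simp: gaussian_closed)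
    then have z: "z \<in> gaussian"
      unfolding z_def using tau_gaussian
      by (intro sum_in_gaussian) (auto intro!: gaussian_closed gaussian_power)
    have IH: "card {n. \<eta> (s + n) \<noteq> 0} \<le> m" if rep: "representable m z" for m
    proof -
      obtain M' where M': "multi_expansion \<tau> D z M'" "size M' \<le> m"
        using rep by (auto simp: representable_def)
      have "card {n. \<eta> (s + n) \<noteq> 0} \<le> size M'"
      proof (rule less.IH[OF s(2)])
        show "range (\<lambda>n. \<eta> (s + n)) \<subseteq> D" using less.prems(1) by auto
        show "\<eta> (s + n) = 0" if "N - s \<le> n" for n using that by (intro less.prems(2)) simp
        show "multi_expansion \<tau> D (\<Sum>n<N - s. \<eta> (s + n) * \<tau> ^ n) M'"
          using M'(1) by (simp add: z_def)
        fix j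
        have "card {n \<in> {j..<j + (2 * k + 1)}. \<eta> (s + n) \<noteq> 0} =
            card ((+) s ` {n \<in> {j..<j + (2 * k + 1)}. \<eta> (s + n) \<noteq> 0})"
          by (simp add: card_image)
        also have "\<dots> \<le> card {n \<in> {s + j..<s + j + (2 * k + 1)}. \<eta> n \<noteq> 0}"
          by (intro card_mono) auto
        also have "\<dots> \<le> 1" by (rule less.prems(3))
        finally show "card {n \<in> {j..<j + (2 * k + 1)}. \<eta> (s + n) \<noteq> 0} \<le> 1" .
      qed
      with M'(2) show ?thesis by simp
    qed
    show ?thesis
    proof (cases "\<eta> 0 = 0")
      case True
      then have "multi_expansion \<tau> D (\<tau> * z) M"
        using less.prems(4) shift(1) False by (simp add: s_def)
      then show ?thesis using IH[OF representable_div_tau[OF _ z]] shift(2) False True by simp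
    next
      case nz: False
      then have "multi_expansion \<tau> D (\<eta> 0 + \<tau> ^ (2 * k + 1) * z) M"
        using less.prems(4) shift(1) False by (simp add: s_def)
      moreover have "\<eta> 0 \<in> D - {0}" using nz less.prems(1) by auto
      ultimately obtain m where "size M = Suc m" "representable m z"
        using representable_remove_digit z by blast
      then show ?thesis using IH shift(2) False nz by simp
    qed
  qed
qed

end

lemma diagonal_base_root:
  assumes "p \<in> {-2, 2 :: int}" "\<tau>\<^sup>2 - of_int p * \<tau> + 2 = 0"
  shows "\<bar>Re \<tau>\<bar> = 1" "\<bar>Im \<tau>\<bar> = 1"
proof -
  \<comment> \<open>\<open>c = p / 2\<close>, and \<open>c\<^sup>2 = 1\<close> turns the equation into \<open>(\<tau> - c)\<^sup>2 = -1\<close>.\<close>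
  obtain c :: complex where c: "of_int p = 2 * c" "c = 1 \<or> c = -1"
    using assms(1) by (auto intro: that[of 1] that[of "-1"])
  have "(\<tau> - c - \<i>) * (\<tau> - c + \<i>) = 0"
    using assms(2) c by (auto simp: algebra_simps power2_eq_square)
  then have "\<tau> - c - \<i> = 0 \<or> \<tau> - c + \<i> = 0" unfolding mult_eq_0_iff .
  then have "Re \<tau> = Re c \<and> (Im \<tau> = Im c + 1 \<or> Im \<tau> = Im c - 1)"
    by (auto simp: complex_eq_iff)
  with c(2) show "\<bar>Re \<tau>\<bar> = 1" "\<bar>Im \<tau>\<bar> = 1" by auto
qed

theorem theorem9p1:
  fixes p q :: int and \<tau> z :: complex and w :: nat and D :: "complex set"
    and \<eta> :: "nat \<Rightarrow> complex"
  assumes "p \<in> {-2, 2}" and "q = 2"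
    and "\<tau>\<^sup>2 - of_int p * \<tau> + of_int q = 0"
    and "odd w" and "w \<ge> 3"
    and "minimal_norm_digit_set \<tau> w D"
    and "z \<in> int_adjoin \<tau>"
    and "wNAF_expansion \<tau> w D z \<eta>"
  shows "optimal_expansion \<tau> D z \<eta>"
proof -
  obtain k where w: "w = 2 * k + 1" using assms(4) by (auto elim: oddE)
  interpret diagonal_digits \<tau> k D
    by unfold_locales (use diagonal_base_root[of p \<tau>] assms w in auto)
  have fin: "finite {n. \<eta> n \<noteq> 0}" and ran: "range \<eta> \<subseteq> D"
    and exp: "expansion \<tau> D z \<eta>" "multi_expansion \<tau> D z (digit_mset \<eta>)"
    and sparse: "\<And>j. card {n \<in> {j..<j + (2 * k + 1)}. \<eta> n \<noteq> 0} \<le> 1"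
    using assms(8) by (auto simp: wNAF_expansion_def expansion_def w)
  have inj: "inj_on (\<lambda>n. (\<eta> n, n)) {n. \<eta> n \<noteq> 0}" by (auto simp: inj_on_def)
  obtain N where supp: "{n. \<eta> n \<noteq> 0} \<subseteq> {..<N}"
    using finite_nat_set_iff_bounded[of "{n. \<eta> n \<noteq> 0}"] fin by blast
  then have N: "\<And>n. N \<le> n \<Longrightarrow> \<eta> n = 0" by (auto simp: subset_iff not_less[symmetric])
  have "z = (\<Sum>(d, n)\<in>#digit_mset \<eta>. d * \<tau> ^ n)" using exp(2) by (simp add: multi_expansion_def)
  also have "\<dots> = (\<Sum>n\<in>{n. \<eta> n \<noteq> 0}. \<eta> n * \<tau> ^ n)"
    by (simp add: digit_mset_def flip: sum_unfold_sum_mset) (simp add: sum.reindex[OF inj])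
  also have "\<dots> = (\<Sum>n<N. \<eta> n * \<tau> ^ n)"
    using supp by (intro sum.mono_neutral_left) auto
  finally have z: "z = (\<Sum>n<N. \<eta> n * \<tau> ^ n)" .
  have "size (digit_mset \<eta>) = card {n. \<eta> n \<noteq> 0}"
    by (simp add: digit_mset_def card_image[OF inj])
  then show ?thesis
    using exp(1) wNAF_weight_le[OF ran N sparse] z by (auto simp: optimal_expansion_def)
qed

end
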